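(* Let $p$ be a prime, and let $\mathbb{F}_p$ denote the field with $p$ elements. Then every subset $A \subseteq \mathbb{F}_p \setminus \{0\}$ of size $|A| \leq \frac{\log p}{\log\log p}$ has a valid ordering, i.e., there is an ordering $a_1, \ldots, a_{|A|}$ of the elements of $A$ such that the partial sums $a_1,\ a_1+a_2,\ \ldots,\ a_1+a_2+\cdots+a_{|A|}$ are pairwise distinct.
   Context: Here $\log$ denotes the natural logarithm. *)

theory Defs
  imports Complex_Main "HOL-Number_Theory.Residues"
begin

text \<open>
  The list \<open>xs\<close> is 0-indexed, so the sum over \<open>{..<k}\<close> is the \<open>k\<close>-th partial sum. The empty
  sum (\<open>k = 0\<close>) is not one of the sums that have to differ: a nonempty partial sum may vanish.
\<close>

definition valid_ordering :: "('a, 'b) ring_scheme \<Rightarrow> 'a set \<Rightarrow> 'a list \<Rightarrow> bool" where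
  "valid_ordering R A xs \<longleftrightarrow>
     distinct xs \<and> set xs = A \<and>
     inj_on (\<lambda>k. \<Oplus>\<^bsub>R\<^esub>i\<in>{..<k}. xs ! i) {1..length xs}"

end

theory Submission
  imports Defs "HOL-Analysis.Analysis"
begin

text \<open>
  Two partial sums agree iff a contiguous block of the sequence, not starting at its first entry,
  sums to zero. With \<open>k = card A\<close>, the bound on \<open>k\<close> gives \<open>k ^ k < p\<close> (apart from the sets with at
  most three elements, which are ordered by hand), so by Dirichlet's theorem a dilate of \<open>A\<close> has
  representatives of absolute value less than \<open>p / k\<close>. All subset sums of these integers are
  less than \<open>p\<close> in absolute value, so it suffices to order them such that no block sums to zero
  in the integers. If their total \<open>S\<close> is not zero, this can be done with all prefix sums at
  least \<open>min 0 S\<close>, by induction: if \<open>S > 0\<close>, start with a suitable positive element; if \<open>S < 0\<close>, end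
  with a suitable negative one. If \<open>S = 0\<close>, put an arbitrary element in front of such an ordering of
  the others.
\<close>

section \<open>Removing an element without making the sum vanish\<close>

text \<open>If removing a positive \<open>a\<close> leaves a nonempty set of sum zero, that set
  contains another positive \<open>b\<close>. The total is then \<open>a\<close>, so removing
  \<open>b\<close> leaves \<open>a - b\<close>, which is nonzero.\<close>

lemma ex_positive_sum_Diff_nonzero:
  fixes B :: "'a::linordered_idom set"
  assumes "finite B" "0 \<notin> B" "0 < \<Sum>B"
  obtains a where "a \<in> B" "0 < a" "B = {a} \<or> \<Sum>(B - {a}) \<noteq> 0"
proof -
  obtain a where a: "a \<in> B" "0 < a"
    using assms by (meson not_less sum_nonpos)
  show ?thesis
  proof (cases "B = {a} \<or> \<Sum>(B - {a}) \<noteq> 0")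
    case True
    then show ?thesis using that a by blast
  next
    case False
    then obtain c where c: "c \<in> B - {a}" using a by blast
    have "\<exists>b\<in>B - {a}. 0 < b"
    proof (rule ccontr)
      assume "\<not> (\<exists>b\<in>B - {a}. 0 < b)"
      then have "\<forall>b\<in>B - {a}. 0 \<le> - b" by (simp add: not_less)
      moreover have "(\<Sum>b\<in>B - {a}. - b) = 0" using False by (simp add: sum_negf)
      ultimately have "\<forall>b\<in>B - {a}. - b = 0"
        using \<open>finite B\<close> sum_nonneg_eq_0_iff[of "B - {a}" uminus] by blast
      with c have "c = 0" by simp
      with c \<open>0 \<notin> B\<close> show False by simp
    qed
    then obtain b where b: "b \<in> B" "b \<noteq> a" "0 < b" by blast
    then have "\<Sum>(B - {b}) \<noteq> 0"
      using False a \<open>finite B\<close> by (auto simp: sum_diff1)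
    then show ?thesis using that b by blast
  qed
qed

lemma ex_negative_sum_Diff_nonzero:
  fixes B :: "'a::linordered_idom set"
  assumes "finite B" "0 \<notin> B" "\<Sum>B < 0"
  obtains a where "a \<in> B" "a < 0" "B = {a} \<or> \<Sum>(B - {a}) \<noteq> 0"
proof -
  have neg: "\<Sum>(uminus ` C) = - \<Sum>C" for C :: "'a set"
    by (simp add: sum.reindex sum_negf)
  have "finite (uminus ` B)" "0 \<notin> uminus ` B" "0 < \<Sum>(uminus ` B)"
    using assms neg[of B] by auto
  then obtain a where a: "a \<in> uminus ` B" "0 < a"
      "uminus ` B = {a} \<or> \<Sum>(uminus ` B - {a}) \<noteq> 0"
    by (rule ex_positive_sum_Diff_nonzero)
  then obtain b where b: "b \<in> B" "a = - b" by blast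
  have "uminus ` {b} = {a}" "uminus ` (B - {b}) = uminus ` B - {a}"
    using b(2) by auto
  then have "B = {b} \<or> \<Sum>(B - {b}) \<noteq> 0"
    using a(3) neg[of "B - {b}"] inj_image_eq_iff[OF inj_uminus, of B "{b}"] by auto
  with a(2) b that show ?thesis by simp
qed

section \<open>Lists without zero-sum blocks\<close>

text \<open>Over a group this says that all prefix sums, the empty one included, are pairwise
  distinct.\<close>

definition zero_block_free :: "'a::monoid_add list \<Rightarrow> bool" where
  "zero_block_free xs \<longleftrightarrow> (\<forall>us vs ws. xs = us @ vs @ ws \<longrightarrow> vs \<noteq> [] \<longrightarrow> sum_list vs \<noteq> 0)"

lemma zero_block_free_ConsI:
  assumes "zero_block_free xs"
    and "\<And>us ws. xs = us @ ws \<Longrightarrow> a + sum_list us \<noteq> 0"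
  shows "zero_block_free (a # xs)"
  unfolding zero_block_free_def
proof (intro allI impI)
  fix us vs ws
  assume eq: "a # xs = us @ vs @ ws" and "vs \<noteq> []"
  show "sum_list vs \<noteq> 0"
  proof (cases us)
    case Nil
    with eq \<open>vs \<noteq> []\<close> obtain vs' where "vs = a # vs'" "xs = vs' @ ws"
      by (cases vs) auto
    then show ?thesis using assms(2) by simp
  next
    case (Cons b us')
    with eq have "xs = us' @ vs @ ws" by simp
    then show ?thesis using assms(1) \<open>vs \<noteq> []\<close> unfolding zero_block_free_def by blast
  qed
qed

lemma zero_block_free_snocI:
  assumes "zero_block_free xs"
    and "\<And>us ws. xs = us @ ws \<Longrightarrow> sum_list ws + a \<noteq> 0"
  shows "zero_block_free (xs @ [a])"
  unfolding zero_block_free_def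
proof (intro allI impI)
  fix us vs ws
  assume eq: "xs @ [a] = us @ vs @ ws" and "vs \<noteq> []"
  show "sum_list vs \<noteq> 0"
  proof (cases ws rule: rev_cases)
    case Nil
    with eq \<open>vs \<noteq> []\<close> obtain vs' where "vs = vs' @ [a]" "xs = us @ vs'"
      by (cases vs rule: rev_cases) auto
    then show ?thesis using assms(2) by simp
  next
    case (snoc ws' b)
    with eq have "xs = us @ vs @ ws'" by simp
    then show ?thesis using assms(1) \<open>vs \<noteq> []\<close> unfolding zero_block_free_def by blast
  qed
qed

lemma zero_block_free_tl: "zero_block_free xs \<Longrightarrow> zero_block_free (tl xs)"
proof (cases xs)
  case (Cons a xs')
  assume free: "zero_block_free xs"
  show ?thesis
    unfolding zero_block_free_def
  proof (intro allI impI)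
    fix us vs ws
    assume "tl xs = us @ vs @ ws" "vs \<noteq> []"
    with Cons have "xs = (a # us) @ vs @ ws" by simp
    with free \<open>vs \<noteq> []\<close> show "sum_list vs \<noteq> 0"
      unfolding zero_block_free_def by blast
  qed
qed simp

text \<open>The lower bound on prefix sums is the strengthening that carries the induction: it
  controls exactly the new blocks that arise when an element is added at either end.\<close>

lemma ex_zero_block_free_ordering:
  fixes B :: "'a::linordered_idom set"
  assumes "finite B" "0 \<notin> B" "\<Sum>B \<noteq> 0"
  obtains xs where "distinct xs" "set xs = B" "zero_block_free xs"
    "\<And>us ws. xs = us @ ws \<Longrightarrow> min 0 (\<Sum>B) \<le> sum_list us"
proof -
  have "\<exists>xs. distinct xs \<and> set xs = B \<and> zero_block_free xs \<and>
      (\<forall>us ws. xs = us @ ws \<longrightarrow> min 0 (\<Sum>B) \<le> sum_list us)"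
    using assms
  proof (induction "card B" arbitrary: B rule: less_induct)
    case less
    \<comment> \<open>The singleton is split off because its remainder has sum zero, which the
      induction hypothesis excludes; the empty list serves there.\<close>
    have IH: "\<exists>xs. distinct xs \<and> set xs = B - {a} \<and> zero_block_free xs \<and>
        (\<forall>us ws. xs = us @ ws \<longrightarrow> min 0 (\<Sum>B - a) \<le> sum_list us)"
      if "a \<in> B" "B = {a} \<or> \<Sum>(B - {a}) \<noteq> 0" for a
    proof (cases "B = {a}")
      case True
      then show ?thesis by (simp add: zero_block_free_def)
    next
      case False
      have "card (B - {a}) < card B"
        using less.prems(1) that(1) by (rule card_Diff1_less)
      with less.hyps[of "B - {a}"] that False less.prems show ?thesis
        by (simp add: sum_diff1)
    qed
    consider "0 < \<Sum>B" | "\<Sum>B < 0" using less.prems(3) by linarith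
    then show ?case
    proof cases
      case 1
      obtain a where a: "a \<in> B" "0 < a" "B = {a} \<or> \<Sum>(B - {a}) \<noteq> 0"
        using ex_positive_sum_Diff_nonzero[OF less.prems(1,2) 1] .
      from IH[OF a(1,3)] obtain xs where xs: "distinct xs" "set xs = B - {a}" "zero_block_free xs"
          and pre: "\<And>us ws. xs = us @ ws \<Longrightarrow> min 0 (\<Sum>B - a) \<le> sum_list us"
        by blast
      \<comment> \<open>Both \<open>0\<close> and \<open>\<Sum>B - a\<close> exceed
        \<open>- a\<close>.\<close>
      have pos: "0 < a + sum_list us" if "xs = us @ ws" for us ws
        using pre[OF that] 1 a(2) by (auto simp: min_def split: if_splits)
      have "zero_block_free (a # xs)"
        using xs(3) by (rule zero_block_free_ConsI) (use pos in force)
      moreover have "min 0 (\<Sum>B) \<le> sum_list us" if "a # xs = us @ ws" for us ws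
      proof (cases us)
        case (Cons b us')
        with that have "b = a" "xs = us' @ ws" by auto
        with pos Cons have "0 < sum_list us" by simp
        then show ?thesis by (rule min.coboundedI1[OF less_imp_le])
      qed simp
      moreover have "distinct (a # xs)" "set (a # xs) = B" using xs a(1) by auto
      ultimately show ?thesis by blast
    next
      case 2
      obtain a where a: "a \<in> B" "a < 0" "B = {a} \<or> \<Sum>(B - {a}) \<noteq> 0"
        using ex_negative_sum_Diff_nonzero[OF less.prems(1,2) 2] .
      from IH[OF a(1,3)] obtain xs where xs: "distinct xs" "set xs = B - {a}" "zero_block_free xs"
          and pre: "\<And>us ws. xs = us @ ws \<Longrightarrow> min 0 (\<Sum>B - a) \<le> sum_list us"
        by blast
      have total: "sum_list xs = \<Sum>B - a"
        using xs(1,2) a(1) less.prems(1) by (simp add: distinct_sum_list_conv_Sum sum_diff1)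
      \<comment> \<open>The left side is \<open>\<Sum>B - sum_list us\<close>, hence at most
        \<open>max (\<Sum>B) a\<close>, and both of these are negative.\<close>
      have neg: "sum_list ws + a < 0" if "xs = us @ ws" for us ws
        using pre[OF that] total that 2 a(2) by (auto simp: min_def split: if_splits)
      have "zero_block_free (xs @ [a])"
        using xs(3) by (rule zero_block_free_snocI) (use neg in force)
      moreover have "min 0 (\<Sum>B) \<le> sum_list us" if "xs @ [a] = us @ ws" for us ws
      proof (cases ws rule: rev_cases)
        case Nil
        with that total have "sum_list us = \<Sum>B" by auto
        then show ?thesis by simp
      next
        case (snoc ws' b)
        with that have "xs = us @ ws'" by simp
        from pre[OF this] a(2) 2 show ?thesis by (auto simp: min_def split: if_splits)
      qed
      moreover have "distinct (xs @ [a])" "set (xs @ [a]) = B" using xs a(1) by auto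
      ultimately show ?thesis by blast
    qed
  qed
  then show ?thesis using that by blast
qed

text \<open>Exempting the first entry allows total zero, where a nonempty list is itself a zero
  block.\<close>

corollary ex_ordering_tl_zero_block_free:
  fixes B :: "'a::linordered_idom set"
  assumes "finite B" "0 \<notin> B"
  obtains xs where "distinct xs" "set xs = B" "zero_block_free (tl xs)"
proof (cases "\<Sum>B = 0")
  case False
  obtain xs where "distinct xs" "set xs = B" "zero_block_free xs"
    using ex_zero_block_free_ordering[OF assms False] .
  then show ?thesis
    using that[OF _ _ zero_block_free_tl] by blast
next
  case True
  show ?thesis
  proof (cases "B = {}")
    case True
    then show ?thesis using that[of "[]"] by (simp add: zero_block_free_def)
  next
    case False
    then obtain a where a: "a \<in> B" by blast
    then have "\<Sum>(B - {a}) \<noteq> 0"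
      using assms True by (auto simp: sum_diff1)
    moreover have "finite (B - {a})" "0 \<notin> B - {a}" using assms by auto
    ultimately obtain xs where "distinct xs" "set xs = B - {a}" "zero_block_free xs"
      using ex_zero_block_free_ordering[of "B - {a}"] by metis
    with a have "distinct (a # xs)" "set (a # xs) = B" "zero_block_free (tl (a # xs))" by auto
    then show ?thesis by (rule that)
  qed
qed

section \<open>From block sums to partial sums in the residue ring\<close>

lemma valid_ordering_residue_ringI:
  assumes "1 < m" "A \<subseteq> carrier (residue_ring m)" "distinct xs" "set xs = A"
    and block: "\<And>us vs ws. tl xs = us @ vs @ ws \<Longrightarrow> vs \<noteq> [] \<Longrightarrow> \<not> m dvd sum_list vs"
  shows "valid_ordering (residue_ring m) A xs"
proof -
  interpret residues m "residue_ring m"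
    using assms(1) by unfold_locales simp_all
  have partial_sum: "(\<Oplus>\<^bsub>residue_ring m\<^esub>i\<in>{..<k}. xs ! i) = sum_list (take k xs) mod m"
    if "k \<le> length xs" for k
  proof -
    have mem: "xs ! i \<in> carrier (residue_ring m)" if "i < k" for i
      using that \<open>k \<le> length xs\<close> assms(2,4) by (meson less_le_trans nth_mem subsetD)
    \<comment> \<open>Entries in the carrier are their own remainders; writing \<open>mod m\<close>
      explicitly lets \<open>sum_cong\<close> turn the ring sum into an integer sum.\<close>
    have "(\<Oplus>\<^bsub>residue_ring m\<^esub>i\<in>{..<k}. xs ! i) = (\<Oplus>\<^bsub>residue_ring m\<^esub>i\<in>{..<k}. (xs ! i) mod m)"
      using mem by (intro finsum_cong') (auto simp: res_carrier_eq)
    also have "\<dots> = (\<Sum>i<k. xs ! i) mod m" by (simp add: sum_cong)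
    also have "(\<Sum>i<k. xs ! i) = sum_list (take k xs)"
      using that by (simp add: sum_list_sum_nth atLeast0LessThan)
    finally show ?thesis .
  qed
  have "sum_list (take i xs) mod m \<noteq> sum_list (take j xs) mod m"
    if ij: "1 \<le> i" "i < j" "j \<le> length xs" for i j
  proof
    assume eq: "sum_list (take i xs) mod m = sum_list (take j xs) mod m"
    define vs where "vs = take (j - i) (drop i xs)"
    have "take j xs = take i xs @ vs"
      using ij unfolding vs_def by (metis le_add_diff_inverse less_imp_le take_add)
    with eq have "m dvd sum_list vs"
      by (metis add_diff_cancel_left' mod_eq_dvd_iff sum_list_append)
    \<comment> \<open>Since \<open>1 \<le> i\<close>, the block avoids the first entry; indices in
      \<open>tl xs\<close> shift by one.\<close>
    moreover have "tl xs = take (i - 1) (tl xs) @ vs @ drop j xs"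
    proof -
      have "drop (i - 1) (tl xs) = drop i xs"
        using ij by (simp add: drop_Suc[symmetric])
      moreover have "drop i xs = vs @ drop j xs"
        using ij unfolding vs_def by (metis add.commute append_take_drop_id drop_drop le_add_diff_inverse2 less_imp_le)
      ultimately show ?thesis by (metis append_take_drop_id)
    qed
    moreover have "vs \<noteq> []" using ij by (simp add: vs_def)
    ultimately show False using block by blast
  qed
  then have "inj_on (\<lambda>k. \<Oplus>\<^bsub>residue_ring m\<^esub>i\<in>{..<k}. xs ! i) {1..length xs}"
    by (intro linorder_inj_onI) (auto simp: partial_sum)
  with assms(3,4) show ?thesis by (simp add: valid_ordering_def)
qed

section \<open>Dilation to small representatives\<close>

text \<open>Approximate all \<open>a / p\<close> with a common denominator \<open>q\<close> so that
  each \<open>q * a / p\<close> is within \<open>1 / card A\<close> of an integer. Multiplying by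
  \<open>p\<close> turns these errors into the representatives.\<close>

lemma simultaneous_dilation:
  fixes A :: "int set" and p :: nat
  assumes "finite A" "A \<noteq> {}" "card A ^ card A < p"
  obtains q r where "0 < q" "q < int p"
    "\<And>a. a \<in> A \<Longrightarrow> [r a = q * a] (mod int p)"
    "\<And>a. a \<in> A \<Longrightarrow> \<bar>r a\<bar> * int (card A) < int p"
proof -
  let ?k = "card A"
  have k: "0 < ?k" using assms by (simp add: card_gt_0_iff)
  have p: "0 < p" using assms(3) by simp
  obtain f where f: "bij_betw f A {0..<?k}"
    using assms(1) ex_bij_betw_finite_nat by blast
  \<comment> \<open>The number of reals and the precision are both \<open>card A\<close>, whence the
    bound \<open>card A ^ card A\<close> on \<open>q\<close>.\<close>
  obtain q P where q: "0 < q" "q \<le> int (?k ^ ?k)"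
    and P: "\<And>i. i < ?k \<Longrightarrow>
      \<bar>of_int q * (real_of_int (inv_into A f i) / real p) - of_int (P i)\<bar> < 1 / real ?k"
    using Dirichlet_approx_simult[OF k, of ?k "\<lambda>i. real_of_int (inv_into A f i) / real p"] by blast
  define r where "r a = q * a - P (f a) * int p" for a
  have "\<bar>r a\<bar> * int ?k < int p" if "a \<in> A" for a
  proof -
    have "f a < ?k" "inv_into A f (f a) = a"
      using f that by (auto simp: bij_betw_def)
    from P[OF this(1)] this(2)
    have "\<bar>of_int q * (real_of_int a / real p) - of_int (P (f a))\<bar> < 1 / real ?k" by simp
    also have "of_int q * (real_of_int a / real p) - of_int (P (f a)) = of_int (r a) / real p"
      using p by (simp add: r_def field_simps)
    finally have "\<bar>real_of_int (r a)\<bar> * real ?k < real p"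
      using p k by (simp add: field_simps)
    then have "real_of_int (\<bar>r a\<bar> * int ?k) < real_of_int (int p)" by simp
    then show ?thesis by (simp only: of_int_less_iff)
  qed
  moreover have "[r a = q * a] (mod int p)" for a
    by (simp add: r_def cong_iff_dvd_diff)
  moreover have "q < int p" using q(2) assms(3) by linarith
  ultimately show ?thesis using that q(1) by blast
qed

section \<open>Transfer of the integer ordering to residues\<close>

lemma ex_valid_ordering_if_power_card_less:
  fixes p :: nat and A :: "int set"
  assumes "prime p" and A: "A \<subseteq> {1..<int p}" and "card A ^ card A < p"
  shows "\<exists>xs. valid_ordering (residue_ring (int p)) A xs"
proof (cases "A = {}")
  case True
  then show ?thesis by (simp add: valid_ordering_def)
next
  case False
  have fin: "finite A" using A finite_subset by blast
  have p: "prime (int p)" "1 < int p" using \<open>prime p\<close> prime_gt_1_nat by auto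
  obtain q r where q: "0 < q" "q < int p"
    and r: "\<And>a. a \<in> A \<Longrightarrow> [r a = q * a] (mod int p)"
    and small: "\<And>a. a \<in> A \<Longrightarrow> \<bar>r a\<bar> * int (card A) < int p"
    using simultaneous_dilation[OF fin False assms(3)] by metis
  \<comment> \<open>As \<open>0 < q < p\<close>, the dilation is invertible modulo \<open>p\<close>;
    this gives injectivity of \<open>r\<close> and carries block sums back to
    \<open>A\<close>.\<close>
  have dvd_q: "int p dvd q * x \<longleftrightarrow> int p dvd x" for x
    using p(1) q prime_dvd_mult_iff zdvd_not_zless by blast
  have inj: "inj_on r A"
  proof (rule inj_onI)
    fix a b assume ab: "a \<in> A" "b \<in> A" "r a = r b"
    then have "[q * a = q * b] (mod int p)" using r by (metis cong_sym cong_trans)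
    then have "int p dvd q * (a - b)"
      by (simp add: cong_iff_dvd_diff right_diff_distrib)
    then have "int p dvd a - b" by (simp only: dvd_q)
    then have "[a = b] (mod int p)" by (simp add: cong_iff_dvd_diff)
    then show "a = b" using A ab by (intro cong_less_imp_eq_int) auto
  qed
  have "0 \<notin> r ` A"
  proof
    assume "0 \<in> r ` A"
    then obtain a where a: "a \<in> A" "r a = 0" by force
    then have "int p dvd a" using r[of a] dvd_q by (metis cong_dvd_iff dvd_0_right)
    then show False using a(1) A zdvd_not_zless by force
  qed
  with fin obtain ys where ys: "distinct ys" "set ys = r ` A" "zero_block_free (tl ys)"
    by (metis ex_ordering_tl_zero_block_free finite_imageI)
  \<comment> \<open>This makes every nonzero subset sum of the representatives too small to be a
    multiple of \<open>p\<close>.\<close>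
  have abs_sum: "(\<Sum>b\<in>r ` A. \<bar>b\<bar>) < int p"
  proof -
    let ?k = "int (card A)"
    have "(\<Sum>b\<in>r ` A. \<bar>b\<bar>) * ?k = (\<Sum>a\<in>A. \<bar>r a\<bar> * ?k)"
      by (simp add: sum.reindex[OF inj] sum_distrib_right)
    also have "\<dots> < (\<Sum>a\<in>A. int p)"
      using fin False small by (intro sum_strict_mono) auto
    finally have "(\<Sum>b\<in>r ` A. \<bar>b\<bar>) * ?k < int p * ?k" by (simp add: mult.commute)
    then show ?thesis by (rule mult_right_less_imp_less) simp
  qed
  let ?g = "inv_into A r"
  have "valid_ordering (residue_ring (int p)) A (map ?g ys)"
  proof (rule valid_ordering_residue_ringI)
    show "distinct (map ?g ys)"
      using ys by (simp add: distinct_map inj_on_inv_into)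
    show "set (map ?g ys) = A"
      using ys(2) inj by (simp add: image_comp)
    show "A \<subseteq> carrier (residue_ring (int p))"
      using A by (auto simp: residue_ring_def)
    fix us vs ws
    assume eq: "tl (map ?g ys) = us @ vs @ ws" and "vs \<noteq> []"
    then have "map ?g (tl ys) = us @ vs @ ws" by (simp add: map_tl)
    then obtain us' vs' ws' where block: "tl ys = us' @ vs' @ ws'" "vs = map ?g vs'"
      by (auto simp: map_eq_append_conv append_eq_map_conv)
    have "set (tl ys) \<subseteq> r ` A" "distinct (tl ys)"
      using ys(1,2) by (cases ys; auto)+
    then have vs': "distinct vs'" "set vs' \<subseteq> r ` A"
      using block(1) by auto
    have nonzero: "sum_list vs' \<noteq> 0"
      using ys(3) block \<open>vs \<noteq> []\<close> unfolding zero_block_free_def by blast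
    have "\<bar>sum_list vs'\<bar> = \<bar>\<Sum>(set vs')\<bar>"
      using vs'(1) by (simp add: distinct_sum_list_conv_Sum)
    also have "\<dots> \<le> (\<Sum>b\<in>set vs'. \<bar>b\<bar>)" by (rule sum_abs)
    also have "\<dots> \<le> (\<Sum>b\<in>r ` A. \<bar>b\<bar>)"
      using vs'(2) fin by (intro sum_mono2) auto
    also note abs_sum
    finally have "\<not> int p dvd sum_list vs'"
      using dvd_imp_le_int[OF nonzero, of "int p"] by auto
    moreover have "[sum_list (map r (map ?g vs')) = q * sum_list (map ?g vs')] (mod int p)"
    proof -
      have "[sum_list (map r zs) = q * sum_list zs] (mod int p)" if "set zs \<subseteq> A" for zs
        using that
      proof (induction zs)
        case (Cons a zs)
        then have "[r a + sum_list (map r zs) = q * a + q * sum_list zs] (mod int p)"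
          by (intro cong_add r) simp_all
        then show ?case by (simp add: distrib_left)
      qed simp
      moreover have "set (map ?g vs') \<subseteq> A"
        using vs'(2) by (metis image_mono image_set inj inv_into_image_cancel subset_image_iff)
      ultimately show ?thesis by blast
    qed
    moreover have "map r (map ?g vs') = vs'"
      unfolding map_map using vs'(2) f_inv_into_f[of _ r A] by (intro map_idI) (simp add: subset_iff)
    ultimately show "\<not> int p dvd sum_list vs"
      using block(2) dvd_q by (metis cong_dvd_iff)
  qed (use p in simp)
  then show ?thesis by blast
qed

section \<open>Sets with at most three elements\<close>

text \<open>Up to two elements leave at most one nonzero entry in the tail. For three, the last two
  must not cancel; \<open>b + c\<close> and \<open>a + c\<close> cannot both vanish modulo
  \<open>m\<close>, so \<open>a\<close> or \<open>b\<close> can go first.\<close>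

lemma ex_valid_ordering_card_le_3:
  fixes m :: int and A :: "int set"
  assumes "1 < m" and A: "A \<subseteq> {1..<m}" and "card A \<le> 3"
  shows "\<exists>xs. valid_ordering (residue_ring m) A xs"
proof -
  have carrier: "A \<subseteq> carrier (residue_ring m)"
    using A by (auto simp: residue_ring_def)
  have ndvd: "\<not> m dvd a" if "a \<in> A" for a
    using that A zdvd_not_zless by force
  have fin: "finite A" using A finite_subset by blast
  consider xs where "set xs = A" "distinct xs" "length xs \<le> 2"
    | a b c where "A = {a, b, c}" "distinct [a, b, c]" "\<not> m dvd b + c"
  proof (cases "card A \<le> 2")
    case True
    then show ?thesis using that(1) finite_distinct_list[OF fin] distinct_card by metis
  next
    case False
    with assms(3) have "card A = 3" by simp
    then obtain a b c where abc: "A = {a, b, c}" "distinct [a, b, c]"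
      by (auto simp: card_3_iff)
    show ?thesis
    proof (cases "m dvd b + c")
      case True
      have "\<not> m dvd a + c"
      proof
        assume "m dvd a + c"
        with True have "[a = b] (mod m)"
          by (metis add_diff_cancel_right cong_iff_dvd_diff dvd_diff)
        then have "a = b" using A abc(1) by (intro cong_less_imp_eq_int) auto
        with abc(2) show False by simp
      qed
      then show ?thesis using that(2)[of b a c] abc by auto
    next
      case False
      then show ?thesis using that(2) abc by blast
    qed
  qed
  then show ?thesis
  proof cases
    case (1 xs)
    have "\<not> m dvd sum_list vs" if "tl xs = us @ vs @ ws" "vs \<noteq> []" for us vs ws
    proof -
      have "length (tl xs) \<le> 1" using 1(3) by simp
      with that have "length vs = 1" by (cases vs) auto
      moreover have "set vs \<subseteq> set xs"
        using that(1) by (cases xs) auto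
      ultimately obtain v where "vs = [v]" "v \<in> set xs"
        by (auto simp: length_Suc_conv)
      then show ?thesis using ndvd 1(1) by simp
    qed
    then show ?thesis
      using valid_ordering_residue_ringI[OF assms(1) carrier] 1 by blast
  next
    case (2 a b c)
    have "\<not> m dvd sum_list vs" if "tl [a, b, c] = us @ vs @ ws" "vs \<noteq> []" for us vs ws
    proof -
      have "vs = [b] \<or> vs = [c] \<or> vs = [b, c]"
        using that by (auto simp: Cons_eq_append_conv)
      then show ?thesis using ndvd 2 by auto
    qed
    then show ?thesis
      using valid_ordering_residue_ringI[OF assms(1) carrier, of "[a, b, c]"] 2 by auto
  qed
qed

section \<open>Numerical estimates for the logarithmic bound\<close>

text \<open>Compares fifth powers: \<open>exp 1 ^ 8\<close> is below \<open>2.72 ^ 8\<close>, about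
  2996, while \<open>5 ^ 5\<close> is 3125.\<close>

lemma ln_5_ge: "8 / 5 \<le> ln (5 :: real)"
proof -
  have "exp (8 / 5 :: real) ^ 5 = exp 1 ^ 8"
    by (simp flip: exp_of_nat_mult)
  also have "\<dots> \<le> (272 / 100) ^ 8"
    using e_less_272 by (intro power_mono) auto
  also have "\<dots> \<le> 5 ^ 5" by (simp add: power_divide)
  finally have "exp (8 / 5 :: real) \<le> 5"
    by (rule power_le_imp_le_base[of _ 4, simplified]) simp
  then show ?thesis by (subst ln_ge_iff) simp_all
qed

text \<open>
  The bound \<open>4 \<le> k\<close> is needed because \<open>ln (ln x) < 1\<close> for \<open>x < exp (exp 1)\<close>: for example,
  \<open>k = 3\<close> satisfies the last hypothesis for \<open>x = 5\<close>.
\<close>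

lemma power_self_le_if_le_ln_div_ln_ln:
  fixes k :: nat and x :: real
  assumes "4 \<le> k" "5 \<le> x" "real k \<le> ln x / ln (ln x)"
  shows "real k ^ k \<le> x"
proof -
  define y where "y = ln x"
  have y: "8 / 5 \<le> y"
    using ln_5_ge assms(2) unfolding y_def by (smt (verit) ln_le_cancel_iff)
  have pos: "0 < ln y" using y by simp
  have le: "real k * ln y \<le> y"
    using assms(3) pos by (simp add: y_def field_simps)
  \<comment> \<open>This gives \<open>1 \<le> ln y\<close>, so \<open>k \<le> y\<close> and
    \<open>k * ln k \<le> k * ln y \<le> y\<close>. Otherwise \<open>4 * ln y \<le> y\<close> for
    some \<open>y\<close> in \<open>[8/5, 2.72)\<close>, which is refuted by bounding
    \<open>ln y = ln 2 + ln (y / 2)\<close> from below.\<close>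
  have "exp 1 \<le> y"
  proof (rule ccontr)
    assume "\<not> exp 1 \<le> y"
    then have "y < 272 / 100" using e_less_272 by linarith
    have "1 - 2 / y \<le> ln (y / 2)"
      using ln_le_minus_one[of "2 / y"] y by (simp add: ln_div)
    then have "5 / 3 - 2 / y \<le> ln y"
      using ln2_ge_two_thirds y by (simp add: ln_div)
    then have "4 * (5 / 3 - 2 / y) \<le> 4 * ln y" by (rule mult_left_mono) simp
    also have "\<dots> \<le> real k * ln y"
      using assms(1) pos by (intro mult_right_mono) auto
    also note le
    finally have "4 * (5 / 3 - 2 / y) \<le> y" .
    then have "20 / 3 * y - 8 \<le> y * y"
      using y by (simp add: field_simps)
    \<comment> \<open>The product yields \<open>y * y \<le> 33 / 5 * y - 8\<close>, contradicting
      the previous bound because \<open>33 / 5 < 20 / 3\<close>.\<close>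
    moreover have "0 \<le> (y - 8 / 5) * (5 - y)"
      using y \<open>y < 272 / 100\<close> by (intro mult_nonneg_nonneg) auto
    moreover have "(y - 8 / 5) * (5 - y) = 33 / 5 * y - 8 - y * y" by (simp add: field_simps)
    ultimately show False using y by linarith
  qed
  then have "1 \<le> ln y" using y by (simp add: ln_ge_iff)
  then have "real k * 1 \<le> real k * ln y" by (intro mult_left_mono) auto
  with le have "real k \<le> y" by simp
  have "real k * ln (real k) \<le> real k * ln y"
    using assms(1) \<open>real k \<le> y\<close> by (intro mult_left_mono) auto
  also have "\<dots> \<le> ln x" using le by (simp add: y_def)
  finally have "ln (real k ^ k) \<le> ln x" using assms(1) by (simp add: ln_realpow)
  then show ?thesis using assms(1,2) by (subst (asm) ln_le_cancel_iff) auto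
qed

theorem theorem2:
  fixes p :: nat and A :: "int set"
  assumes "prime p"
    and "A \<subseteq> carrier (residue_ring (int p)) - {\<zero>\<^bsub>residue_ring (int p)\<^esub>}"
    and "real (card A) \<le> ln (real p) / ln (ln (real p))"
  shows "\<exists>xs. valid_ordering (residue_ring (int p)) A xs"
proof -
  have A: "A \<subseteq> {1..<int p}"
    using assms(2) by (force simp: residue_ring_def)
  show ?thesis
  proof (cases "card A \<le> 3")
    case True
    then show ?thesis
      using ex_valid_ordering_card_le_3[OF _ A] prime_gt_1_nat[OF assms(1)] by simp
  next
    case False
    have "card A \<le> p - 1"
      using card_mono[OF _ A] by simp
    with False have "5 \<le> real p" by simp
    with False assms(3) have "real (card A) ^ card A \<le> real p"
      by (intro power_self_le_if_le_ln_div_ln_ln) auto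
    then have "card A ^ card A \<le> p" by (simp flip: of_nat_power)
    \<comment> \<open>A power with exponent at least 4 is not prime; this supplies the strict
      inequality for the dilation.\<close>
    moreover have "card A ^ card A \<noteq> p"
      using False assms(1) by (auto simp: prime_power_iff)
    ultimately show ?thesis
      using ex_valid_ordering_if_power_card_less[OF assms(1) A] by simp
  qed
qed

end
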